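(* Let $n\ge 2$ and let $k$ be a positive integer with $\gcd(k,n)=1$ and $k\equiv\pm1\pmod n$. Then $\Delta=H_0$, and for every pair of distinct nonzero $v_1,v_2\in\mathbb{F}_{2^n}$, $$\bigl|\{(x,y,z)\in\Delta^3:\ v_1x+v_2y+(v_1+v_2)z=0\}\bigr|=2^{2n-3}.$$
   Context: $\mathbb{F}_{2^n}$ is the field with $2^n$ elements, $\operatorname{Tr}(x)=\sum_{i=0}^{n-1}x^{2^i}$ is the absolute trace, and $H_0=\{x\in\mathbb{F}_{2^n}:\operatorname{Tr}(x)=0\}$. Put $F(x)=x^{4^k-2^k+1}$ for $x\in\mathbb{F}_{2^n}$, $\delta(b)=F(b)+F(b+1)+1$, and $\Delta=\{\delta(b): b\in\mathbb{F}_{2^n}\}$. *)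

theory Defs
  imports "HOL-Number_Theory.Cong" "HOL-Library.Cardinality"
begin

text \<open>
  The field with \<open>2^n\<close> elements is modelled by a type \<open>'a\<close> of class \<open>field\<close> with
  \<open>CARD('a) = 2^n\<close>. That hypothesis is imposed where the notions below are used; \<open>n\<close> is passed
  explicitly to those that depend on it.
\<close>

definition abs_trace :: "nat \<Rightarrow> 'a::field \<Rightarrow> 'a" where
  "abs_trace n x = (\<Sum>i<n. x ^ (2 ^ i))"

definition H0 :: "nat \<Rightarrow> 'a::field set" where
  "H0 n = {x. abs_trace n x = 0}"

text \<open>The exponent is a natural number; its subtraction does not truncate, since \<open>2^k \<le> 4^k\<close>.\<close>

definition F :: "nat \<Rightarrow> 'a::field \<Rightarrow> 'a" where
  "F k x = x ^ (4 ^ k - 2 ^ k + 1)"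

definition \<delta> :: "nat \<Rightarrow> 'a::field \<Rightarrow> 'a" where
  "\<delta> k b = F k b + F k (b + 1) + 1"

definition \<Delta> :: "nat \<Rightarrow> 'a::field set" where
  "\<Delta> k = range (\<delta> k)"

end

theory Submission
  imports Defs "HOL-Computational_Algebra.Polynomial"
begin

text \<open>
  If \<open>k \<equiv> \<plusminus>1\<close>, then \<open>F\<close> is the cube map up to a power of Frobenius, so \<open>\<Delta>\<close> is the image of
  \<open>u \<mapsto> u\<^sup>2 + u\<close>; this map is two-to-one and has trace \<open>0\<close>, so its image is \<open>H\<^sub>0\<close> by counting.
  Since \<open>H\<^sub>0\<close> is an additive group, the substitution \<open>a = x + z\<close>, \<open>b = y + z\<close> turns the
  equation into \<open>v\<^sub>1 a + v\<^sub>2 b = 0\<close> with \<open>z\<close> free, and it remains to count the \<open>a\<close> for which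
  \<open>a\<close> and \<open>(v\<^sub>1 / v\<^sub>2) a\<close> both have trace \<open>0\<close>. These are two independent linear conditions,
  because \<open>Tr (c (u\<^sup>2 + u)) = Tr ((c + c\<^sup>2) u\<^sup>2)\<close> vanishes for all \<open>u\<close> only if \<open>c \<in> {0, 1}\<close>.
\<close>

section \<open>Two counting facts by permuting or translating elements\<close>

text \<open>Multiplication by a nonzero \<open>x\<close> permutes the nonzero elements, so their
  product absorbs one factor \<open>x\<close> per element and can be cancelled.\<close>

lemma finite_field_power_card:
  fixes x :: "'a::{field,finite}"
  shows "x ^ CARD('a) = x"
proof (cases "x = 0")
  case False
  let ?U = "- {0 :: 'a}"
  have "bij_betw ((*) x) ?U ?U"
    by (rule bij_betw_byWitness[where f' = "\<lambda>y. y / x"]) (use False in auto)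
  from prod.reindex_bij_betw[OF this, of "\<lambda>y. y"]
  have "\<Prod>?U = (\<Prod>y\<in>?U. x * y)"
    by (rule sym)
  also have "\<dots> = x ^ card ?U * \<Prod>?U"
    by (simp only: prod.distrib prod_constant)
  finally have "x ^ card ?U = 1"
    by simp
  moreover have "CARD('a) = Suc (card ?U)"
    unfolding Compl_eq_Diff_UNIV by (rule card.remove) simp_all
  ultimately show ?thesis
    by (simp only: power_Suc mult_1_right)
qed (simp add: card_gt_0_iff)

text \<open>Translation by \<open>g\<close> exchanges the zeros of \<open>f\<close> in
  \<open>S\<close> with the points of value 1. It serves both for the trace on the whole field and
  for \<open>a\<close> \<mapsto> Tr(\<open>c * a\<close>) on \<open>H0 n\<close>.\<close>

lemma card_kernel_of_binary_functional:
  fixes S :: "'a::{ab_group_add,finite} set" and f :: "'a \<Rightarrow> 'b::{ring_1}"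
  assumes closed: "\<And>x y. x \<in> S \<Longrightarrow> y \<in> S \<Longrightarrow> x + y \<in> S"
    and double: "\<And>x :: 'a. x + x = 0"
    and additive: "\<And>x y. f (x + y) = f x + f y"
    and binary: "\<And>x. f x = 0 \<or> f x = 1"
    and two: "(2 :: 'b) = 0"
    and g: "g \<in> S" "f g = 1"
  shows "card S = 2 * card {x \<in> S. f x = 0}"
proof -
  let ?K = "{x \<in> S. f x = 0}" and ?L = "{x \<in> S. f x = 1}"
  have shift: "x + g + g = x" for x
    by (simp add: add.assoc double)
  have "bij_betw (\<lambda>x. x + g) ?K ?L"
    by (rule bij_betw_byWitness[where f' = "\<lambda>x. x + g"])
      (auto simp: shift additive g closed two)
  then have "card ?L = card ?K"
    by (simp add: bij_betw_same_card)
  moreover have "S = ?K \<union> ?L" "?K \<inter> ?L = {}"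
    using binary by auto
  then have "card S = card ?K + card ?L"
    by (metis (lifting) card_Un_disjoint finite)
  ultimately show ?thesis
    by simp
qed

section \<open>Characteristic two and Frobenius\<close>

context
  fixes n :: nat
  assumes card_field: "CARD('a::{field,finite}) = 2 ^ n" and n_pos: "n > 0"
begin

lemma power_two_power_n: "(x :: 'a) ^ 2 ^ n = x"
  using finite_field_power_card[of x] by (simp add: card_field)

lemma two_eq_0: "(2 :: 'a) = 0"
proof -
  \<comment> \<open>The exponent \<open>2 ^ n\<close> is even because \<open>n > 0\<close>, which
    forces -1 = 1.\<close>
  have "(- 1 :: 'a) = (- 1) ^ 2 ^ n"
    by (rule power_two_power_n[symmetric])
  also have "\<dots> = 1"
    using n_pos by simp
  finally have "1 + 1 = (0 :: 'a)"
    by (simp only: neg_eq_iff_add_eq_0)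
  then show ?thesis
    by simp
qed

lemma add_self: "(x :: 'a) + x = 0"
  by (simp add: two_eq_0 flip: mult_2)

lemma add_eq_0_iff_eq: "(x :: 'a) + y = 0 \<longleftrightarrow> x = y"
  using add_left_cancel[of x y x] by (auto simp: add_self)

lemma frobenius_add: "((x :: 'a) + y) ^ 2 ^ i = x ^ 2 ^ i + y ^ 2 ^ i"
proof (induction i)
  case (Suc i)
  have "((x + y) ^ 2 ^ i) ^ 2 = (x ^ 2 ^ i) ^ 2 + (y ^ 2 ^ i) ^ 2"
    by (simp add: Suc power2_sum two_eq_0)
  then show ?case
    by (simp add: mult.commute flip: power_mult)
qed simp

text \<open>Frobenius exponents matter only modulo \<open>n\<close>; this is how the congruence on
  \<open>k\<close> enters, with \<open>j = 1\<close> or \<open>j = 0\<close>.\<close>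

lemma power_two_power_mult_add: "(x :: 'a) ^ 2 ^ (n * m + j) = x ^ 2 ^ j"
proof (induction m)
  case (Suc m)
  have "x ^ 2 ^ (n * Suc m + j) = (x ^ 2 ^ n) ^ 2 ^ (n * m + j)"
    by (simp add: power_add mult_ac flip: power_mult)
  then show ?case
    by (simp add: power_two_power_n Suc)
qed simp

section \<open>The absolute trace\<close>

lemma abs_trace_add: "abs_trace n ((x :: 'a) + y) = abs_trace n x + abs_trace n y"
  by (simp add: abs_trace_def frobenius_add sum.distrib)

text \<open>Squaring moves each summand to the next; the difference telescopes to
  \<open>x ^ 2 ^ n - x\<close>, which is zero.\<close>

lemma abs_trace_power2: "abs_trace n ((x :: 'a)\<^sup>2) = abs_trace n x"
proof -
  have "(\<Sum>i<n. x ^ 2 ^ Suc i - x ^ 2 ^ i) = 0"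
    by (subst sum_lessThan_telescope) (simp add: power_two_power_n)
  then show ?thesis
    by (simp add: abs_trace_def sum_subtractf flip: power_mult)
qed

lemma power2_abs_trace: "(abs_trace n (x :: 'a))\<^sup>2 = abs_trace n x"
proof -
  have "(\<Sum>i\<in>I. f i)\<^sup>2 = (\<Sum>i\<in>I. (f i)\<^sup>2)" if "finite I" for I and f :: "nat \<Rightarrow> 'a"
    using that by induction (simp_all add: power2_sum two_eq_0)
  then have "(abs_trace n x)\<^sup>2 = abs_trace n (x\<^sup>2)"
    by (simp add: abs_trace_def mult.commute flip: power_mult)
  then show ?thesis
    by (simp add: abs_trace_power2)
qed

lemma abs_trace_binary: "abs_trace n (x :: 'a) = 0 \<or> abs_trace n x = 1"
  using power2_abs_trace[of x] by (simp add: power2_eq_square)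

text \<open>The trace is a polynomial of degree \<open>2 ^ (n - 1)\<close>, less than the size of the field.\<close>

lemma abs_trace_surj: "\<exists>x :: 'a. abs_trace n x = 1"
proof (rule ccontr)
  assume "\<nexists>x :: 'a. abs_trace n x = 1"
  then have *: "abs_trace n (x :: 'a) = 0" for x
    using abs_trace_binary by blast
  define p :: "'a poly" where "p = (\<Sum>i<n. monom 1 (2 ^ i))"
  have "coeff p (2 ^ (n - 1)) = 1"
    using n_pos by (simp add: p_def coeff_sum)
  then have "p \<noteq> 0"
    by auto
  have "poly p x = 0" for x
    using *[of x] by (simp add: p_def poly_sum poly_monom abs_trace_def)
  then have "2 ^ n \<le> degree p"
    using card_poly_roots_bound[OF \<open>p \<noteq> 0\<close>] by (simp add: card_field)
  also have "degree p \<le> 2 ^ (n - 1)"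
    unfolding p_def
    by (intro degree_sum_le) (auto intro!: order.trans[OF degree_monom_le] power_increasing)
  also have "\<dots> < (2 :: nat) ^ n"
    using n_pos by simp
  finally show False
    by simp
qed

section \<open>The trace-zero subgroup\<close>

lemma H0_add: "(x :: 'a) \<in> H0 n \<Longrightarrow> y \<in> H0 n \<Longrightarrow> x + y \<in> H0 n"
  by (simp add: H0_def abs_trace_add)

lemma card_H0: "2 * card (H0 n :: 'a set) = 2 ^ n"
proof -
  obtain g :: 'a where "abs_trace n g = 1"
    using abs_trace_surj by blast
  then have "CARD('a) = 2 * card {x \<in> UNIV :: 'a set. abs_trace n x = 0}"
    by (intro card_kernel_of_binary_functional[where g = g])
      (simp_all add: add_self abs_trace_add abs_trace_binary two_eq_0)
  then show ?thesis
    by (simp add: card_field H0_def)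
qed

lemma range_power2_add: "range (\<lambda>u :: 'a. u\<^sup>2 + u) = H0 n"
proof (rule card_subset_eq)
  let ?R = "range (\<lambda>u :: 'a. u\<^sup>2 + u)"
  show sub: "?R \<subseteq> H0 n"
    by (auto simp: H0_def abs_trace_add abs_trace_power2 add_self)
  \<comment> \<open>\<open>s\<close> selects one preimage of each value. Every \<open>u\<close> is a
    selected preimage or one plus 1, so the range contains at least half of the field.\<close>
  define s where "s = inv (\<lambda>u :: 'a. u\<^sup>2 + u)"
  have "u \<in> s ` ?R \<union> (\<lambda>y. y + 1) ` s ` ?R" for u
  proof -
    define w where "w = s (u\<^sup>2 + u)"
    have "w\<^sup>2 + w = u\<^sup>2 + u"
      unfolding w_def s_def by (rule f_inv_into_f) simp
    then have "(w - u) * (w + u + 1) = 0"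
      by (simp add: algebra_simps power2_eq_square)
    then have "w = u \<or> (w + 1) + u = 0"
      by (simp add: add_ac)
    then have "u = w \<or> u = w + 1"
      unfolding add_eq_0_iff_eq by blast
    moreover have "w \<in> s ` ?R"
      unfolding w_def by blast
    ultimately show ?thesis
      by blast
  qed
  then have "s ` ?R \<union> (\<lambda>y. y + 1) ` s ` ?R = UNIV"
    by blast
  then have "2 ^ n \<le> card (s ` ?R) + card ((\<lambda>y. y + 1) ` s ` ?R)"
    using card_Un_le[of "s ` ?R" "(\<lambda>y. y + 1) ` s ` ?R"] by (simp only: card_field)
  moreover have "card (s ` ?R) \<le> card ?R" "card ((\<lambda>y. y + 1) ` s ` ?R) \<le> card (s ` ?R)"
    by (rule card_image_le, simp)+
  moreover have "card ?R \<le> card (H0 n :: 'a set)"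
    by (rule card_mono[OF _ sub]) simp
  ultimately show "card ?R = card (H0 n :: 'a set)"
    using card_H0 by linarith
qed simp

lemma card_H0_mult:
  fixes c :: 'a
  assumes "c \<noteq> 0" "c \<noteq> 1"
  shows "4 * card {a \<in> H0 n. c * a \<in> H0 n} = 2 ^ n"
proof -
  have "\<exists>g \<in> H0 n. abs_trace n (c * g) = 1"
  proof (rule ccontr)
    assume "\<not> ?thesis"
    then have *: "abs_trace n (c * g) = 0" if "g \<in> H0 n" for g
      using that abs_trace_binary by blast
    have **: "abs_trace n ((c + c\<^sup>2) * u\<^sup>2) = 0" for u
    proof -
      have "abs_trace n ((c + c\<^sup>2) * u\<^sup>2) = abs_trace n (c * u\<^sup>2) + abs_trace n ((c * u)\<^sup>2)"
        by (simp add: distrib_right power_mult_distrib abs_trace_add)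
      also have "\<dots> = abs_trace n (c * (u\<^sup>2 + u))"
        by (simp add: abs_trace_power2 distrib_left abs_trace_add)
      also have "\<dots> = 0"
        using * range_power2_add by blast
      finally show ?thesis .
    qed
    have "c + c\<^sup>2 = c * (1 + c)"
      by (simp add: power2_eq_square distrib_left)
    then have nz: "c + c\<^sup>2 \<noteq> 0"
      using assms by (simp add: add_eq_0_iff_eq)
    obtain w :: 'a where w: "abs_trace n w = 1"
      using abs_trace_surj by blast
    \<comment> \<open>The power \<open>2 ^ (n - 1)\<close> is the square root. Taking it for
      \<open>u\<close> in the vanishing identity gives \<open>w\<close> trace 0 instead of
      1.\<close>
    have "((w / (c + c\<^sup>2)) ^ 2 ^ (n - 1))\<^sup>2 = w / (c + c\<^sup>2)"
      using n_pos power_two_power_n[of "w / (c + c\<^sup>2)"]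
      by (simp only: power_mult[symmetric] power_minus_mult)
    then show False
      using **[of "(w / (c + c\<^sup>2)) ^ 2 ^ (n - 1)"] w nz by simp
  qed
  then obtain g where "g \<in> H0 n" "abs_trace n (c * g) = 1"
    by blast
  then have "card (H0 n :: 'a set) = 2 * card {a \<in> H0 n. abs_trace n (c * a) = 0}"
    by (intro card_kernel_of_binary_functional[where g = g])
      (simp_all add: H0_add add_self distrib_left abs_trace_add abs_trace_binary two_eq_0)
  then show ?thesis
    using card_H0 by (simp add: H0_def)
qed

section \<open>Counting the triples\<close>

lemma card_H0_triples:
  fixes v1 v2 :: 'a
  assumes "v1 \<noteq> 0" "v2 \<noteq> 0" "v1 \<noteq> v2"
  shows "8 * card {(x, y, z). x \<in> H0 n \<and> y \<in> H0 n \<and> z \<in> H0 n \<and>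
                     v1 * x + v2 * y + (v1 + v2) * z = 0} = 2 ^ (2 * n)"
proof -
  define c where "c = v1 / v2"
  have c: "c \<noteq> 0" "c \<noteq> 1" and v1: "v1 = v2 * c"
    using assms by (auto simp: c_def)
  let ?T = "{(x, y, z). x \<in> H0 n \<and> y \<in> H0 n \<and> z \<in> H0 n \<and>
              v1 * x + v2 * y + (v1 + v2) * z = 0}"
  let ?A = "{a \<in> H0 n. c * a \<in> H0 n}"
  have cancel: "x + z + z = x" for x z :: 'a
    by (simp add: add.assoc add_self)
  have equation: "v1 * x + v2 * y + (v1 + v2) * z = 0 \<longleftrightarrow> c * (x + z) = y + z" for x y z
  proof -
    have "v1 * x + v2 * y + (v1 + v2) * z = v2 * (c * (x + z) + (y + z))"
      by (simp add: v1 algebra_simps)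
    then show ?thesis
      using assms by (simp add: add_eq_0_iff_eq)
  qed
  \<comment> \<open>The pair \<open>a = x + z\<close> and \<open>z\<close> determines the triple,
    since the equation forces \<open>y + z = c * a\<close>.\<close>
  have "bij_betw (\<lambda>(a, z). (a + z, c * a + z, z)) (?A \<times> H0 n) ?T"
    by (rule bij_betw_byWitness[where f' = "\<lambda>(x, y, z). (x + z, z)"])
      (auto simp: equation cancel H0_add)
  from bij_betw_same_card[OF this] have "card ?T = card ?A * card (H0 n :: 'a set)"
    by (simp only: card_cartesian_product)
  then have "8 * card ?T = (4 * card ?A) * (2 * card (H0 n :: 'a set))"
    by simp
  also have "\<dots> = 2 ^ n * 2 ^ n"
    by (simp only: card_H0_mult[OF c] card_H0)
  finally show ?thesis
    by (simp only: mult_2 power_add)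
qed

section \<open>The power function and its differential set\<close>

lemma F_mult: "F k (x :: 'a) * x ^ 2 ^ k = (x ^ 2 ^ k) ^ 2 ^ k * x"
proof -
  have "(2 :: nat) ^ k \<le> 4 ^ k"
    by (simp add: power_mono)
  then have "4 ^ k - 2 ^ k + 1 + 2 ^ k = 2 ^ k * 2 ^ k + (1 :: nat)"
    by (simp flip: power_mult_distrib)
  then show ?thesis
    unfolding F_def power_mult[symmetric] power_add[symmetric] by simp
qed

text \<open>Multiplying \<open>F k x\<close> by \<open>x ^ 2 ^ k\<close> removes the subtraction
  from the exponent, and then \<open>u\<^sup>2\<close> cancels. Both signs of the congruence fit:
  \<open>u\<close> is \<open>x\<close> for 1 and the fourth root of \<open>x\<close> for -1.\<close>

lemma F_eq_power3:
  fixes x u :: 'a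
  assumes "x ^ 2 ^ k = u\<^sup>2" "(x ^ 2 ^ k) ^ 2 ^ k * x = u ^ 5"
  shows "F k x = u ^ 3"
proof (cases "u = 0")
  case True
  then show ?thesis
    using assms by (simp add: F_def)
next
  case False
  have "F k x * u\<^sup>2 = u ^ (3 + 2)"
    using F_mult[of k x] assms by simp
  then have "F k x * u\<^sup>2 = u ^ 3 * u\<^sup>2"
    by (simp only: power_add)
  then show ?thesis
    using False by (simp only: mult_right_cancel power_eq_0_iff not_False_eq_True simp_thms)
qed

lemma \<Delta>_eq_H0:
  assumes "[int k = 1] (mod int n) \<or> [int k = - 1] (mod int n)" and "k > 0"
  shows "(\<Delta> k :: 'a set) = H0 n"
proof -
  \<comment> \<open>These properties reduce \<delta> to the cube map evaluated at
    \<open>s x\<close>; surjectivity lets \<open>s x\<close> run through the whole field.\<close>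
  have "\<exists>s :: 'a \<Rightarrow> 'a. (\<forall>x. F k x = s x ^ 3) \<and> (\<forall>x. s (x + 1) = s x + 1) \<and> surj s"
    using assms(1)
  proof
    assume "[int k = 1] (mod int n)"
    then have "n dvd k - 1"
      using \<open>k > 0\<close> by (simp add: cong_iff_dvd_diff of_nat_diff flip: int_dvd_int_iff)
    then obtain m where "k - 1 = n * m"
      by (rule dvdE)
    then have "k = n * m + 1"
      using \<open>k > 0\<close> by simp
    then have frob: "(x :: 'a) ^ 2 ^ k = x\<^sup>2" for x
      using power_two_power_mult_add[of x m 1] by simp
    have "F k (x :: 'a) = x ^ 3" for x
      by (rule F_eq_power3) (simp_all add: frob flip: power_mult power_Suc2)
    then show ?thesis
      by (intro exI[of _ id]) auto
  next
    assume "[int k = - 1] (mod int n)"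
    then have "n dvd k + 1"
      by (simp add: cong_iff_dvd_diff add.commute flip: int_dvd_int_iff)
    then obtain m where m: "k + 1 = n * m"
      by (rule dvdE)
    have frob: "((x :: 'a) ^ 2 ^ k)\<^sup>2 = x" for x
      using power_two_power_mult_add[of x m 0] unfolding add_0_right m[symmetric]
      by (simp add: mult.commute flip: power_mult)
    \<comment> \<open>By \<open>frob\<close>, raising to the power \<open>2 ^ k\<close> takes square
      roots, so \<open>s\<close> takes fourth roots.\<close>
    define s where "s = (\<lambda>x :: 'a. (x ^ 2 ^ k) ^ 2 ^ k)"
    have s2: "(s x)\<^sup>2 = x ^ 2 ^ k" for x
      by (simp add: s_def frob)
    have s4: "s x ^ 4 = x" for x
    proof -
      have "s x ^ 4 = ((s x)\<^sup>2)\<^sup>2"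
        by (simp flip: power_mult)
      then show ?thesis
        by (simp only: s2 frob)
    qed
    have "F k x = s x ^ 3" for x
    proof (rule F_eq_power3)
      have "s x ^ 5 = s x * s x ^ 4"
        by (simp flip: power_Suc)
      then show "(x ^ 2 ^ k) ^ 2 ^ k * x = s x ^ 5"
        by (simp add: s4) (simp add: s_def)
    qed (simp add: s2)
    moreover have "s (x + 1) = s x + 1" for x
      by (simp add: s_def frobenius_add)
    moreover have "s (x ^ 4) = x" for x
      using s4[of x] unfolding s_def by (simp only: power_mult[symmetric] mult_ac)
    then have "surj s"
      by (rule surjI[where f = "\<lambda>x. x ^ 4"])
    ultimately show ?thesis
      by blast
  qed
  then obtain s :: "'a \<Rightarrow> 'a"
    where s: "F k x = s x ^ 3" "s (x + 1) = s x + 1" and "surj s" for x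
    by blast
  have "\<delta> k x = (s x)\<^sup>2 + s x" for x
  proof -
    \<comment> \<open>The binomial expansion of \<open>(s x + 1) ^ 3\<close>, with the even part
      split off.\<close>
    have "\<delta> k x = (s x)\<^sup>2 + s x + 2 * (s x ^ 3 + (s x)\<^sup>2 + s x + 1)"
      unfolding \<delta>_def s by (simp add: algebra_simps power2_eq_square power3_eq_cube)
    then show ?thesis
      by (simp add: two_eq_0)
  qed
  then have "\<Delta> k = (\<lambda>u. u\<^sup>2 + u) ` range s"
    by (auto simp: \<Delta>_def)
  then show ?thesis
    by (simp add: \<open>surj s\<close> range_power2_add)
qed

end

theorem theorem7p1:
  fixes n k :: nat
  assumes "CARD('a::{field,finite}) = 2 ^ n"
    and "n \<ge> 2"
    and "k > 0"
    and "gcd k n = 1"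
    and "[int k = 1] (mod int n) \<or> [int k = -1] (mod int n)"
  shows "(\<Delta> k :: 'a set) = H0 n \<and>
    (\<forall>v1 v2 :: 'a. v1 \<noteq> 0 \<longrightarrow> v2 \<noteq> 0 \<longrightarrow> v1 \<noteq> v2 \<longrightarrow>
      card {(x, y, z). x \<in> \<Delta> k \<and> y \<in> \<Delta> k \<and> z \<in> \<Delta> k \<and>
                       v1 * x + v2 * y + (v1 + v2) * z = 0} = 2 ^ (2 * n - 3))"
proof -
  have n: "n > 0"
    using assms(2) by simp
  \<comment> \<open>Since \<open>n \<ge> 2\<close>, the exponent \<open>2 * n - 3\<close> does not
    truncate.\<close>
  have "2 ^ (2 * n) = 8 * (2 :: nat) ^ (2 * n - 3)"
    using assms(2) power_add[of "2 :: nat" 3 "2 * n - 3"] by simp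
  then show ?thesis
    using card_H0_triples[OF assms(1) n] unfolding \<Delta>_eq_H0[OF assms(1) n assms(5,3)] by simp
qed

end
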